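(* Let $F$ be a field with a valuation $v$, valuation ring $O_v$ and value group $\Gamma_v$, let $E/F$ be a finite field extension, and let $w$ be a quasi-valuation on $E$ extending $v$ such that $w(E\setminus\{0\})$ is torsion over $\Gamma_v$. Then $O_w=\{x\in E\mid w(x)\ge0\}$ satisfies GU (going up) over $O_v$: for any prime ideals $P_0\subseteq P_1$ of $O_v$ and every prime ideal $Q_0$ of $O_w$ with $Q_0\cap O_v=P_0$ there is a prime ideal $Q_1\supseteq Q_0$ of $O_w$ with $Q_1\cap O_v=P_1$.
   Context: A totally ordered abelian monoid is a commutative monoid $(M,+)$ with a total order such that $a\le b$ implies $a+c\le b+c$. One adjoins $\infty$, greater than all elements of $M$, with $m+\infty=\infty$. A quasi-valuation on a ring $A$ is a function $w:A\to M\cup\{\infty\}$, $M$ a totally ordered abelian monoid, with $w(0)=\infty$, $w(xy)\ge w(x)+w(y)$ and $w(x+y)\ge\min\{w(x),w(y)\}$ for all $x,y\in A$. $w$ extends $v$ means that $\Gamma_v$ is contained in $M$ as an ordered submonoid and $w|_F=v$. For $x\neq 0$ one has $w(x)\neq\infty$. "$w(E\setminus\{0\})$ is torsion over $\Gamma_v$" means: for every $0\ne x\in E$ there is an integer $k\ge1$ with $k\,w(x)\in\Gamma_v$. *)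

theory Defs
  imports "HOL-Algebra.Algebra"
begin

section \<open>Adjoining infinity to an ordered monoid\<close>

datatype 'm with_infinity = Fin 'm | Infty

instantiation with_infinity :: (order) order
begin

definition less_eq_with_infinity :: "'a with_infinity \<Rightarrow> 'a with_infinity \<Rightarrow> bool" where
  "a \<le> b \<longleftrightarrow>
     (case b of Infty \<Rightarrow> True
      | Fin y \<Rightarrow> (case a of Infty \<Rightarrow> False | Fin x \<Rightarrow> x \<le> y))"

definition less_with_infinity :: "'a with_infinity \<Rightarrow> 'a with_infinity \<Rightarrow> bool" where
  "a < b \<longleftrightarrow> a \<le> b \<and> \<not> b \<le> (a :: 'a with_infinity)"

instance
  by standard (auto simp: less_eq_with_infinity_def less_with_infinity_def
      split: with_infinity.splits)

end

instance with_infinity :: (linorder) linorder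
  by standard (auto simp: less_eq_with_infinity_def split: with_infinity.splits)

instantiation with_infinity :: (comm_monoid_add) comm_monoid_add
begin

definition zero_with_infinity :: "'a with_infinity" where
  "0 = Fin 0"

definition plus_with_infinity ::
    "'a with_infinity \<Rightarrow> 'a with_infinity \<Rightarrow> 'a with_infinity" where
  "a + b =
     (case a of Infty \<Rightarrow> Infty
      | Fin x \<Rightarrow> (case b of Infty \<Rightarrow> Infty | Fin y \<Rightarrow> Fin (x + y)))"

instance
  by standard (auto simp: zero_with_infinity_def plus_with_infinity_def ac_simps
      split: with_infinity.splits)

end

instance with_infinity :: (ordered_comm_monoid_add) ordered_comm_monoid_add
  by standard (auto simp: less_eq_with_infinity_def plus_with_infinity_def add_left_mono
      split: with_infinity.splits)

lemma with_infinity_simps [simp]: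
  "Fin x \<le> Fin y \<longleftrightarrow> x \<le> y" "a \<le> Infty" "\<not> Infty \<le> Fin x"
  "Fin x < Fin y \<longleftrightarrow> x < y" "Fin x < Infty" "\<not> Infty < a"
  for x y :: "'a::order"
  by (auto simp: less_eq_with_infinity_def less_with_infinity_def less_le_not_le
      split: with_infinity.splits)

lemma with_infinity_plus_simps [simp]:
  "Fin x + Fin y = Fin (x + y)" "a + Infty = Infty" "Infty + a = Infty"
  for x y :: "'a::comm_monoid_add"
  by (auto simp: plus_with_infinity_def split: with_infinity.splits)

section \<open>Valuations and quasi-valuations\<close>

locale valuation = field K for K (structure) +
  fixes v :: "'a \<Rightarrow> 'g::linordered_ab_group_add with_infinity"
  assumes val_eq_Infty_iff: "x \<in> carrier K \<Longrightarrow> v x = Infty \<longleftrightarrow> x = \<zero>"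
    and val_mult: "\<lbrakk>x \<in> carrier K; y \<in> carrier K\<rbrakk> \<Longrightarrow> v (x \<otimes> y) = v x + v y"
    and val_add: "\<lbrakk>x \<in> carrier K; y \<in> carrier K\<rbrakk> \<Longrightarrow> min (v x) (v y) \<le> v (x \<oplus> y)"

locale quasi_valuation = ring A for A (structure) +
  fixes w :: "'a \<Rightarrow> 'm::{linorder, ordered_comm_monoid_add} with_infinity"
  assumes qval_zero: "w \<zero> = Infty"
    and qval_mult: "\<lbrakk>x \<in> carrier A; y \<in> carrier A\<rbrakk> \<Longrightarrow> w x + w y \<le> w (x \<otimes> y)"
    and qval_add: "\<lbrakk>x \<in> carrier A; y \<in> carrier A\<rbrakk> \<Longrightarrow> min (w x) (w y) \<le> w (x \<oplus> y)"

text \<open>The value group is the image of the nonzero elements, which may be a proper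
  subgroup of the type in which \<open>v\<close> takes its values.\<close>

definition value_group ::
    "('a, 'b) ring_scheme \<Rightarrow> ('a \<Rightarrow> 'g with_infinity) \<Rightarrow> 'g set" where
  "value_group K v = {\<gamma>. \<exists>x \<in> carrier K - {\<zero>\<^bsub>K\<^esub>}. v x = Fin \<gamma>}"

text \<open>The sets \<open>O\<^sub>v\<close> and \<open>O\<^sub>w\<close>.\<close>

definition nonneg_ring ::
    "('a, 'b) ring_scheme \<Rightarrow> ('a \<Rightarrow> 'm::{order, comm_monoid_add} with_infinity) \<Rightarrow> 'a set" where
  "nonneg_ring A w = {x \<in> carrier A. 0 \<le> w x}"

text \<open>The inclusion of a set \<open>G\<close> (in practice a value group) into \<open>M\<close> as an ordered
  submonoid is made explicit as a map \<open>\<iota>\<close>, of which only the restriction to \<open>G\<close> matters.\<close>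

definition ordered_monoid_embedding ::
    "'g::{order, comm_monoid_add} set \<Rightarrow> ('g \<Rightarrow> 'm::{order, comm_monoid_add}) \<Rightarrow> bool" where
  "ordered_monoid_embedding G \<iota> \<longleftrightarrow>
     \<iota> 0 = 0 \<and>
     (\<forall>a\<in>G. \<forall>b\<in>G. \<iota> (a + b) = \<iota> a + \<iota> b) \<and>
     (\<forall>a\<in>G. \<forall>b\<in>G. \<iota> a \<le> \<iota> b \<longleftrightarrow> a \<le> b)"

definition extends_valuation ::
    "('a, 'b) ring_scheme \<Rightarrow> ('a \<Rightarrow> 'g::linordered_ab_group_add with_infinity) \<Rightarrow> ('g \<Rightarrow> 'm) \<Rightarrow>
     ('a \<Rightarrow> 'm::{linorder, ordered_comm_monoid_add} with_infinity) \<Rightarrow> bool" where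
  "extends_valuation K v \<iota> w \<longleftrightarrow>
     ordered_monoid_embedding (value_group K v) \<iota> \<and>
     (\<forall>x \<in> carrier K. w x = map_with_infinity \<iota> (v x))"

text \<open>Here \<open>G\<close> is a subset of \<open>M\<close>, and the \<open>k\<close>-fold multiple is taken in \<open>M \<union> {\<infinity>}\<close>;
  in particular torsion forces \<open>w x \<noteq> \<infinity>\<close> for \<open>x \<noteq> 0\<close>.\<close>

definition torsion_over ::
    "('a, 'b) ring_scheme \<Rightarrow> ('a \<Rightarrow> 'm::comm_monoid_add with_infinity) \<Rightarrow> 'm set \<Rightarrow> bool" where
  "torsion_over A w G \<longleftrightarrow>
     (\<forall>x \<in> carrier A - {\<zero>\<^bsub>A\<^esub>}. \<exists>k\<ge>1. (\<Sum>i<(k::nat). w x) \<in> Fin ` G)"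

section \<open>Going up\<close>

text \<open>\<open>B\<close> and \<open>C\<close> are (carriers of) subrings of the ambient ring \<open>R\<close>, with \<open>B \<subseteq> C\<close>.\<close>

definition going_up :: "('a, 'b) ring_scheme \<Rightarrow> 'a set \<Rightarrow> 'a set \<Rightarrow> bool" where
  "going_up R B C \<longleftrightarrow>
     (\<forall>P0 P1 Q0.
        primeideal P0 (R\<lparr>carrier := B\<rparr>) \<and> primeideal P1 (R\<lparr>carrier := B\<rparr>) \<and> P0 \<subseteq> P1 \<and>
        primeideal Q0 (R\<lparr>carrier := C\<rparr>) \<and> Q0 \<inter> B = P0 \<longrightarrow>
        (\<exists>Q1. primeideal Q1 (R\<lparr>carrier := C\<rparr>) \<and> Q0 \<subseteq> Q1 \<and> Q1 \<inter> B = P1))"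

end

theory Submission
  imports Defs
begin

text \<open>Write \<open>J(P)\<close> for the set of those \<open>x \<in> O\<^sub>w\<close> with \<open>w x \<ge> w p\<close> for some \<open>p \<in> P\<close>; it is an ideal
  of \<open>O\<^sub>w\<close>, equal to \<open>P O\<^sub>w\<close>. A prime \<open>Q\<^sub>1\<close> as wanted exists as soon as \<open>Q\<^sub>0 + J(P\<^sub>1)\<close> misses
  \<open>O\<^sub>v - P\<^sub>1\<close>. Otherwise, dividing by an element of \<open>O\<^sub>v - P\<^sub>1\<close>, one finds \<open>q \<in> Q\<^sub>0\<close> and \<open>t \<in> F\<close> with
  \<open>w (1 - q) \<ge> w t > 0\<close>. Reducing an algebraic equation of \<open>q\<close> over \<open>F\<close> modulo \<open>P\<^sub>0\<close> shows that
  \<open>q\<close> is a zero divisor modulo \<open>J(P\<^sub>0)\<close>: there is \<open>b \<in> O\<^sub>w - J(P\<^sub>0)\<close> with \<open>q b \<in> J(P\<^sub>0)\<close>. Hence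
  \<open>w b \<ge> w ((1 - q) b) \<ge> w t + w b\<close>. As \<open>M\<close> need not be cancellative, this is not yet absurd, but
  a multiple of \<open>w b\<close> lies in the group \<open>\<Gamma>\<^sub>v\<close>, where it is.\<close>

section \<open>Ideals, primes avoiding a multiplicative set, and evaluation of coefficient
  lists\<close>

lemma (in ring) idealI_mult_closed:
  assumes "I \<subseteq> carrier R" "\<zero> \<in> I"
    and "\<And>x y. x \<in> I \<Longrightarrow> y \<in> I \<Longrightarrow> x \<oplus> y \<in> I"
    and l: "\<And>x a. x \<in> carrier R \<Longrightarrow> a \<in> I \<Longrightarrow> x \<otimes> a \<in> I"
    and "\<And>x a. x \<in> carrier R \<Longrightarrow> a \<in> I \<Longrightarrow> a \<otimes> x \<in> I"
  shows "ideal I R"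
proof (rule idealI[OF ring_axioms])
  have "\<ominus> a \<in> I" if "a \<in> I" for a
    using l[of "\<ominus> \<one>" a] that assms(1) by (auto simp: l_minus)
  then show "subgroup I (add_monoid R)"
    using assms(1-3) by (intro add.subgroupI) auto
qed (use assms in auto)

lemma (in ring) ideal_subset_set_add:
  assumes "ideal I R" "ideal J R"
  shows "I \<subseteq> I <+> J" "J \<subseteq> I <+> J"
  using genideal_self[of "I \<union> J"] union_genideal[OF assms] assms[THEN ideal.Icarr] by auto

text \<open>Krull's argument: Zorn's lemma gives an ideal that is maximal among those containing
  \<open>I\<close> and missing \<open>S\<close>, and multiplicativity of \<open>S\<close> forces it
  to be prime.\<close>

lemma (in cring) ex_primeideal_disjoint:
  assumes I: "ideal I R" and S: "\<one> \<in> S" "\<And>x y. x \<in> S \<Longrightarrow> y \<in> S \<Longrightarrow> x \<otimes> y \<in> S"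
    and disj: "I \<inter> S = {}"
  obtains Q where "primeideal Q R" "I \<subseteq> Q" "Q \<inter> S = {}"
proof -
  define \<A> where "\<A> = {J. ideal J R \<and> I \<subseteq> J \<and> J \<inter> S = {}}"
  have "\<exists>M\<in>\<A>. \<forall>J\<in>\<A>. M \<subseteq> J \<longrightarrow> J = M"
  proof (rule subset_Zorn_nonempty)
    show "\<A> \<noteq> {}" using I disj by (auto simp: \<A>_def)
    fix C assume C: "C \<noteq> {}" "subset.chain \<A> C"
    then have sub: "\<And>J. J \<in> C \<Longrightarrow> ideal J R \<and> I \<subseteq> J \<and> J \<inter> S = {}"
      by (auto simp: \<A>_def subset.chain_def)
    have "ideal (\<Union>C) R"
    proof (rule idealI_mult_closed)
      show "\<Union>C \<subseteq> carrier R"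
        using sub by (meson Sup_least ideal.Icarr subsetI)
      show "\<zero> \<in> \<Union>C"
        using C(1) sub additive_subgroup.zero_closed ideal.axioms(1) by fastforce
      fix x y assume "x \<in> \<Union>C" "y \<in> \<Union>C"
      then obtain J where "J \<in> C" "x \<in> J" "y \<in> J"
        using subset.chain_total[OF C(2)] by blast
      then show "x \<oplus> y \<in> \<Union>C"
        using sub additive_subgroup.a_closed ideal.axioms(1) by (metis UnionI)
    next
      fix x a assume "x \<in> carrier R" "a \<in> \<Union>C"
      then show "x \<otimes> a \<in> \<Union>C" "a \<otimes> x \<in> \<Union>C"
        using sub by (blast intro: ideal.I_l_closed ideal.I_r_closed)+
    qed
    then show "\<Union>C \<in> \<A>"
      using C(1) sub by (auto simp: \<A>_def)
  qed
  then obtain M where MA: "M \<in> \<A>" and maxA: "\<And>J. J \<in> \<A> \<Longrightarrow> M \<subseteq> J \<Longrightarrow> J = M"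
    by metis
  then have M: "ideal M R" "I \<subseteq> M" "M \<inter> S = {}"
    by (auto simp: \<A>_def)
  have max: "J = M" if "ideal J R" "M \<subseteq> J" "J \<inter> S = {}" for J
    using maxA[of J] that M(2) by (auto simp: \<A>_def)
  interpret M: ideal M R by (rule M(1))
  \<comment> \<open>Adjoining an element outside \<open>M\<close> gives a strictly larger ideal,
    which must meet \<open>S\<close> by maximality.\<close>
  have meets: "\<exists>r\<in>carrier R. \<exists>m\<in>M. r \<otimes> a \<oplus> m \<in> S" if a: "a \<in> carrier R" "a \<notin> M" for a
  proof -
    have id: "ideal (PIdl a <+> M) R"
      by (rule add_ideals[OF cgenideal_ideal[OF a(1)] M(1)])
    note sub = ideal_subset_set_add[OF cgenideal_ideal[OF a(1)] M(1)]
    have "a \<in> PIdl a <+> M"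
      using sub(1) cgenideal_self[OF a(1)] by blast
    then have "(PIdl a <+> M) \<inter> S \<noteq> {}"
      using max[OF id sub(2)] a(2) by blast
    then show ?thesis
      unfolding set_add_def' cgenideal_def by blast
  qed
  have "primeideal M R"
  proof (rule primeidealI[OF M(1) is_cring])
    show "carrier R \<noteq> M" using S(1) M(3) by auto
    fix a b assume ab: "a \<in> carrier R" "b \<in> carrier R" "a \<otimes> b \<in> M"
    show "a \<in> M \<or> b \<in> M"
    proof (rule ccontr)
      assume "\<not> ?thesis"
      then obtain r m r' m' where *: "r \<in> carrier R" "m \<in> M" "r \<otimes> a \<oplus> m \<in> S"
        "r' \<in> carrier R" "m' \<in> M" "r' \<otimes> b \<oplus> m' \<in> S"
        using meets ab by metis
      \<comment> \<open>The product of these two elements of \<open>S\<close> is again in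
        \<open>S\<close>, yet every term of its expansion has a factor \<open>a \<otimes> b\<close>,
        \<open>m\<close> or \<open>m'\<close> from \<open>M\<close>.\<close>
      have "(r \<otimes> a \<oplus> m) \<otimes> (r' \<otimes> b \<oplus> m')
          = (r \<otimes> r') \<otimes> (a \<otimes> b) \<oplus> ((r \<otimes> a) \<otimes> m' \<oplus> m \<otimes> (r' \<otimes> b \<oplus> m'))"
        using * ab M.Icarr by algebra
      moreover have "\<dots> \<in> M"
        using M.I_l_closed[OF ab(3), of "r \<otimes> r'"] M.I_l_closed[of m' "r \<otimes> a"]
          M.I_r_closed[of m "r' \<otimes> b \<oplus> m'"] * ab M.Icarr
        by (intro M.a_closed) auto
      ultimately show False
        using S(2)[OF *(3,6)] M(3) by auto
    qed
  qed
  then show thesis using that M by blast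
qed

text \<open>Serves to divide an algebraic equation by one of its coefficients. The constant term
  stands last in the list, so induction from the right follows Horner's rule.\<close>

lemma (in ring) eval_smult:
  assumes "set p \<subseteq> carrier R" "c \<in> carrier R" "x \<in> carrier R"
  shows "eval (map (\<lambda>a. c \<otimes> a) p) x = c \<otimes> eval p x"
  using assms(1)
proof (induction p rule: rev_induct)
  case (snoc a p)
  have "set (map (\<lambda>a. c \<otimes> a) p) \<subseteq> carrier R" using snoc assms by auto
  then show ?case
    using snoc assms eval_append_aux[of "map (\<lambda>a. c \<otimes> a) p" "c \<otimes> a" x]
      eval_append_aux[of p a x] eval_in_carrier[of p x]
    by (simp add: r_distr m_assoc)
qed (use assms in auto)

section \<open>The two rings of nonnegative elements, and division by elements of the base
  field\<close>

text \<open>The valuation is present only as the restriction of \<open>w\<close> to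
  \<open>F\<close>, so that no embedding of value groups has to be carried along; torsion is stated
  over the values of \<open>w\<close> on nonzero elements of \<open>F\<close>. Finiteness of the
  extension enters as algebraicity.\<close>

locale torsion_quasi_valuation = field E + quasi_valuation E w for E (structure) and w +
  fixes F
  assumes F: "subfield F E"
    and w_one: "w \<one> = 0"
    and w_mult: "\<lbrakk>x \<in> F; y \<in> F\<rbrakk> \<Longrightarrow> w (x \<otimes> y) = w x + w y"
    and torsion: "torsion_over E w {m. \<exists>c\<in>F - {\<zero>}. w c = Fin m}"
    and algebraic: "x \<in> carrier E \<Longrightarrow> (algebraic over F) x"
begin

abbreviation "O_w \<equiv> nonneg_ring E w"
abbreviation "O_F \<equiv> nonneg_ring (E\<lparr>carrier := F\<rparr>) w"

text \<open>The extension of an ideal \<open>P\<close> of \<open>O_F\<close> to \<open>O_w\<close>,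
  encoded by values rather than generators, so that membership can be tested with
  \<open>w\<close>.\<close>

definition value_ideal where "value_ideal P = {x \<in> O_w. \<exists>p\<in>P. w p \<le> w x}"

lemmas F_simps = subringE[OF subfieldE(1)[OF F]] subfield_m_inv[OF F]

lemma F_carrier: "x \<in> F \<Longrightarrow> x \<in> carrier E"
  using F_simps(1) by auto

lemma O_w_iff: "x \<in> O_w \<longleftrightarrow> x \<in> carrier E \<and> 0 \<le> w x"
  by (simp add: nonneg_ring_def)

lemma O_F_iff: "x \<in> O_F \<longleftrightarrow> x \<in> F \<and> 0 \<le> w x"
  by (simp add: nonneg_ring_def)

lemma O_F_subset: "O_F \<subseteq> O_w"
  using F_carrier by (auto simp: O_F_iff O_w_iff)

lemma O_w_mult: "x \<in> O_w \<Longrightarrow> y \<in> O_w \<Longrightarrow> x \<otimes> y \<in> O_w"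
  unfolding O_w_iff by (meson add_nonneg_nonneg m_closed order_trans qval_mult)

lemma O_w_add: "x \<in> O_w \<Longrightarrow> y \<in> O_w \<Longrightarrow> x \<oplus> y \<in> O_w"
  using qval_add[of x y] by (auto simp: O_w_iff min_def split: if_splits)

text \<open>The element \<open>\<ominus> \<one>\<close> lies in \<open>F\<close>, where
  \<open>w\<close> is multiplicative, and its square is \<open>\<one>\<close>. Twice its value is
  therefore 0, so its value cannot be negative.\<close>

lemma O_w_minus: assumes "x \<in> O_w" shows "\<ominus> x \<in> O_w"
proof -
  have "\<ominus> \<one> \<in> F" using F_simps by blast
  then have "w (\<ominus> \<one>) + w (\<ominus> \<one>) = 0"
    using w_mult[of "\<ominus> \<one>" "\<ominus> \<one>"] w_one by (simp add: l_minus)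
  then have "0 \<le> w (\<ominus> \<one>)"
    by (metis add_nonpos_nonpos add.right_neutral add_left_mono linorder_le_cases order_antisym)
  then have "\<ominus> \<one> \<otimes> x \<in> O_w"
    using assms by (intro O_w_mult) (auto simp: O_w_iff)
  then show ?thesis using assms by (simp add: l_minus O_w_iff)
qed

lemma subring_O_w: "subring O_w E"
  by (rule subringI) (use O_w_mult O_w_add O_w_minus w_one in \<open>auto simp: O_w_iff\<close>)

lemma cring_O_w: "cring (E\<lparr>carrier := O_w\<rparr>)"
  using subcringI'[OF subring_O_w] subcring_iff[OF subringE(1)[OF subring_O_w]] by blast

text \<open>Values of nonzero elements of \<open>F\<close> are invertible; this is the substitute
  for cancellation in \<open>M\<close>.\<close>

lemma w_inv: "c \<in> F - {\<zero>} \<Longrightarrow> w (inv c) + w c = 0"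
  using w_mult[of "inv c" c] F_simps w_one by simp

lemma inv_mult_O_F:
  assumes "x \<in> F" "c \<in> F - {\<zero>}" "w c \<le> w x"
  shows "inv c \<otimes> x \<in> O_F"
proof -
  have "w (inv c) + w c \<le> w (inv c) + w x" using assms(3) by (rule add_left_mono)
  then show ?thesis
    using assms w_inv w_mult[of "inv c" x] F_simps by (simp add: O_F_iff)
qed

section \<open>Ideals of the two rings and their extension by values\<close>

lemma ideal_O_FD:
  assumes "ideal P (E\<lparr>carrier := O_F\<rparr>)"
  shows "P \<subseteq> O_F" "\<zero> \<in> P" "\<And>x a. x \<in> O_F \<Longrightarrow> a \<in> P \<Longrightarrow> a \<otimes> x \<in> P"
  using additive_subgroup.a_subset[OF ideal.axioms(1)[OF assms]]
    additive_subgroup.zero_closed[OF ideal.axioms(1)[OF assms]] ideal.I_r_closed[OF assms]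
  by auto

lemma ideal_O_wD:
  assumes "ideal P (E\<lparr>carrier := O_w\<rparr>)"
  shows "P \<subseteq> O_w" "\<zero> \<in> P" "\<And>x a. x \<in> O_w \<Longrightarrow> a \<in> P \<Longrightarrow> a \<otimes> x \<in> P"
    "\<And>x a. x \<in> O_w \<Longrightarrow> a \<in> P \<Longrightarrow> x \<otimes> a \<in> P"
    "\<And>x y. x \<in> P \<Longrightarrow> y \<in> P \<Longrightarrow> x \<oplus> y \<in> P"
  using additive_subgroup.a_subset[OF ideal.axioms(1)[OF assms]]
    additive_subgroup.zero_closed[OF ideal.axioms(1)[OF assms]] ideal.I_r_closed[OF assms]
    ideal.I_l_closed[OF assms] additive_subgroup.a_closed[OF ideal.axioms(1)[OF assms]]
  by auto

lemma ideal_O_w_diff: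
  assumes P: "ideal P (E\<lparr>carrier := O_w\<rparr>)" and "x \<in> P" "x \<oplus> y \<in> P" "y \<in> carrier E"
  shows "y \<in> P"
proof -
  have x: "x \<in> carrier E" using ideal_O_wD(1)[OF P] assms(2) by (auto simp: O_w_iff)
  have "\<ominus> \<one> \<in> O_w" using O_w_minus[of \<one>] w_one by (simp add: O_w_iff)
  then have "\<ominus> \<one> \<otimes> x \<oplus> (x \<oplus> y) \<in> P"
    using assms(2,3) ideal_O_wD(4,5)[OF P] by blast
  also have "\<ominus> \<one> \<otimes> x \<oplus> (x \<oplus> y) = y"
    using x assms(4) by algebra
  finally show ?thesis .
qed

text \<open>Multiplying by an element of nonnegative value keeps the lower bound \<open>w p\<close>,
  and a sum has value at least one of the two bounds of its summands.\<close>

lemma ideal_value_ideal: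
  assumes P: "ideal P (E\<lparr>carrier := O_F\<rparr>)"
  shows "ideal (value_ideal P) (E\<lparr>carrier := O_w\<rparr>)"
proof -
  interpret Ow: cring "E\<lparr>carrier := O_w\<rparr>" by (rule cring_O_w)
  have mult: "x \<otimes> a \<in> value_ideal P" if "x \<in> O_w" "a \<in> value_ideal P" for x a
  proof -
    obtain p where p: "p \<in> P" "w p \<le> w a" and a: "a \<in> O_w"
      using \<open>a \<in> _\<close> by (auto simp: value_ideal_def)
    have "0 + w p \<le> w x + w a" using p that by (intro add_mono) (auto simp: O_w_iff)
    also have "\<dots> \<le> w (x \<otimes> a)" using that a by (intro qval_mult) (auto simp: O_w_iff)
    finally show ?thesis using p O_w_mult[OF \<open>x \<in> O_w\<close> a] by (auto simp: value_ideal_def)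
  qed
  show ?thesis
  proof (rule Ow.idealI_mult_closed)
    show "value_ideal P \<subseteq> carrier (E\<lparr>carrier := O_w\<rparr>)"
      by (auto simp: value_ideal_def)
    show "\<zero>\<^bsub>E\<lparr>carrier := O_w\<rparr>\<^esub> \<in> value_ideal P"
      using ideal_O_FD(2)[OF P] by (auto simp: value_ideal_def O_w_iff qval_zero)
    fix x y assume "x \<in> value_ideal P" "y \<in> value_ideal P"
    then obtain p p' where p: "p \<in> P" "w p \<le> w x" "p' \<in> P" "w p' \<le> w y"
      and xy: "x \<in> O_w" "y \<in> O_w" by (auto simp: value_ideal_def)
    have "w p \<le> w (x \<oplus> y) \<or> w p' \<le> w (x \<oplus> y)"
      using qval_add[of x y] p xy by (fastforce simp: O_w_iff min_def split: if_splits)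
    then show "x \<oplus>\<^bsub>E\<lparr>carrier := O_w\<rparr>\<^esub> y \<in> value_ideal P"
      using p O_w_add[OF xy] by (auto simp: value_ideal_def)
  next
    fix x a assume xa: "x \<in> carrier (E\<lparr>carrier := O_w\<rparr>)" "a \<in> value_ideal P"
    then show 1: "x \<otimes>\<^bsub>E\<lparr>carrier := O_w\<rparr>\<^esub> a \<in> value_ideal P" using mult by simp
    have "a \<in> carrier (E\<lparr>carrier := O_w\<rparr>)" using xa by (auto simp: value_ideal_def)
    then show "a \<otimes>\<^bsub>E\<lparr>carrier := O_w\<rparr>\<^esub> x \<in> value_ideal P"
      using 1 xa(1) Ow.m_comm by metis
  qed
qed

text \<open>By torsion some positive multiple of the value of a nonzero element is finite, while
  \<open>Infty\<close> absorbs every sum.\<close>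

lemma eq_zero_if_w_Infty:
  assumes "x \<in> carrier E" "w x = Infty" shows "x = \<zero>"
proof (rule ccontr)
  assume "x \<noteq> \<zero>"
  then obtain k :: nat and m where k: "k \<ge> 1" "(\<Sum>i<k. w x) = Fin m"
    using torsion assms(1) unfolding torsion_over_def by blast
  then show False
    using assms(2) by (cases k) (auto simp: lessThan_Suc)
qed

text \<open>A nonzero witness \<open>p\<close> divides \<open>x\<close> in \<open>O_w\<close>,
  because \<open>inv p \<otimes> x\<close> has value at least \<open>w (inv p) + w p = 0\<close>.
  The witness \<open>\<zero>\<close> forces \<open>x = \<zero>\<close>.\<close>

lemma value_ideal_subset:
  assumes Q: "ideal Q (E\<lparr>carrier := O_w\<rparr>)" and "P \<subseteq> Q" "P \<subseteq> F"
  shows "value_ideal P \<subseteq> Q"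
proof
  fix x assume "x \<in> value_ideal P"
  then obtain p where p: "p \<in> P" "w p \<le> w x" and x: "x \<in> carrier E" "0 \<le> w x"
    by (auto simp: value_ideal_def O_w_iff)
  show "x \<in> Q"
  proof (cases "p = \<zero>")
    case True
    then have "w x = Infty" using p(2) qval_zero by (cases "w x") auto
    then show ?thesis using eq_zero_if_w_Infty x(1) ideal_O_wD(2)[OF Q] by simp
  next
    case False
    then have pF: "p \<in> F - {\<zero>}" using p assms by auto
    have "w (inv p) + w p \<le> w (inv p) + w x" using p(2) by (rule add_left_mono)
    also have "\<dots> \<le> w (inv p \<otimes> x)"
      using F_simps(8)[OF pF] F_carrier x by (intro qval_mult) auto
    finally have "inv p \<otimes> x \<in> O_w"
      using w_inv[OF pF] F_simps(8)[OF pF] F_carrier x by (auto simp: O_w_iff)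
    then have "p \<otimes> (inv p \<otimes> x) \<in> Q" using p(1) assms(2) ideal_O_wD(3)[OF Q] by blast
    also have "p \<otimes> (inv p \<otimes> x) = x"
      using F_simps(8,9)[OF pF] F_carrier pF x by (metis m_assoc l_one DiffD1)
    finally show ?thesis .
  qed
qed

section \<open>Polynomial equations modulo an extended ideal\<close>

text \<open>An algebraic equation is divided by a coefficient of least value. The coefficient
  \<open>\<one>\<close> that results keeps the equation nontrivial modulo every proper
  ideal.\<close>

lemma ex_primitive_equation:
  assumes x: "x \<in> carrier E"
  obtains p where "set p \<subseteq> O_F" "\<one> \<in> set p" "eval p x = \<zero>"
proof -
  obtain p where p: "p \<in> carrier (F[X]\<^bsub>E\<^esub>)" "p \<noteq> []" "eval p x = \<zero>"
    using algebraicE[OF subfieldE(1)[OF F] x algebraic[OF x]] .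
  then have pol: "set p \<subseteq> F" "lead_coeff p \<noteq> \<zero>" "lead_coeff p \<in> set p"
    by (auto simp: univ_poly_carrier[symmetric] polynomial_def)
  have "Min (w ` set p) \<in> w ` set p" using p(2) by (intro Min_in) auto
  then obtain c where c: "c \<in> set p" "\<And>a. a \<in> set p \<Longrightarrow> w c \<le> w a"
    by (metis (no_types, lifting) List.finite_set Min_le finite_imageI imageE image_eqI)
  \<comment> \<open>The least value is finite because the leading coefficient is nonzero.\<close>
  have "c \<noteq> \<zero>"
  proof
    assume "c = \<zero>"
    then have "w (lead_coeff p) = Infty"
      using c(2)[OF pol(3)] qval_zero by (cases "w (lead_coeff p)") auto
    then show False using eq_zero_if_w_Infty pol F_carrier by blast
  qed
  then have cF: "c \<in> F - {\<zero>}" using c pol by auto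
  show thesis
  proof
    show "set (map (\<lambda>a. inv c \<otimes> a) p) \<subseteq> O_F"
      using inv_mult_O_F[OF _ cF] c pol by auto
    show "\<one> \<in> set (map (\<lambda>a. inv c \<otimes> a) p)"
      using F_simps(10)[OF cF] c(1) by force
    show "eval (map (\<lambda>a. inv c \<otimes> a) p) x = \<zero>"
      using eval_smult[of p "inv c" x] p x pol F_carrier F_simps(8)[OF cF] by auto
  qed
qed

lemma eval_in_O_w: "set p \<subseteq> O_w \<Longrightarrow> x \<in> O_w \<Longrightarrow> eval p x \<in> O_w"
proof (induction p rule: rev_induct)
  case (snoc a p)
  then have "eval (p @ [a]) x = eval p x \<otimes> x \<oplus> a"
    by (intro eval_append_aux) (auto simp: O_w_iff)
  then show ?case using snoc O_w_mult O_w_add by auto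
qed (auto simp: O_w_iff qval_zero)

lemma ex_zero_divisor_mod:
  assumes Q: "ideal Q (E\<lparr>carrier := O_w\<rparr>)" and P: "ideal (Q \<inter> O_F) (E\<lparr>carrier := O_F\<rparr>)"
    and q: "q \<in> Q" and p: "set p \<subseteq> O_F" "\<not> set p \<subseteq> Q" "eval p q \<in> value_ideal (Q \<inter> O_F)"
  shows "\<exists>b\<in>O_w - value_ideal (Q \<inter> O_F). b \<otimes> q \<in> value_ideal (Q \<inter> O_F)"
  using p
proof (induction p rule: rev_induct)
  case (snoc a p)
  let ?J = "value_ideal (Q \<inter> O_F)"
  have JQ: "?J \<subseteq> Q" using Q by (rule value_ideal_subset) (auto simp: O_F_iff)
  have qO: "q \<in> O_w" using q ideal_O_wD(1)[OF Q] by auto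
  have pO: "set p \<subseteq> O_w" "a \<in> O_w" "a \<in> O_F" using snoc.prems O_F_subset by auto
  have eO: "eval p q \<in> O_w" using eval_in_O_w pO qO by blast
  have "eval (p @ [a]) q = eval p q \<otimes> q \<oplus> a"
    using pO qO by (intro eval_append_aux) (auto simp: O_w_iff)
  then have ev: "eval p q \<otimes> q \<oplus> a \<in> ?J" using snoc.prems by simp
  have "eval p q \<otimes> q \<in> Q" using ideal_O_wD(4)[OF Q eO q] .
  moreover have "a \<in> carrier E" using pO(2) by (simp add: O_w_iff)
  ultimately have aQ: "a \<in> Q" using ideal_O_w_diff[OF Q] ev JQ by blast
  then have "a \<in> ?J" using pO by (auto simp: value_ideal_def)
  then have mul: "eval p q \<otimes> q \<in> ?J"
    using ideal_O_w_diff[OF ideal_value_ideal[OF P], of a "eval p q \<otimes> q"] ev eO qO pO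
    by (auto simp: O_w_iff a_comm)
  show ?case
  proof (cases "eval p q \<in> ?J")
    \<comment> \<open>The dropped coefficient \<open>a\<close> is in \<open>Q\<close>, so some
      coefficient outside \<open>Q\<close> remains in \<open>p\<close>.\<close>
    case True
    then show ?thesis using snoc aQ by simp
  next
    case False
    then show ?thesis using mul eO by blast
  qed
qed auto

section \<open>Cancellation through torsion, and elements close to one\<close>

text \<open>Adding \<open>k\<close> copies of the inequality, where \<open>k\<close> times
  \<open>w x\<close> equals \<open>w c\<close> with \<open>c\<close> in \<open>F\<close>, bounds
  \<open>w t + w c\<close> by \<open>w c\<close>; now \<open>w c\<close> can be cancelled.\<close>

lemma not_add_le:
  assumes "x \<in> carrier E" "x \<noteq> \<zero>" "t \<in> F" "0 < w t"
  shows "\<not> w t + w x \<le> w x"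
proof
  assume le: "w t + w x \<le> w x"
  obtain k :: nat and c where k: "k \<ge> 1" and c: "c \<in> F - {\<zero>}" "(\<Sum>i<k. w x) = w c"
    using torsion assms(1,2) unfolding torsion_over_def by fastforce
  obtain l where l: "k = Suc l" using k by (cases k) auto
  \<comment> \<open>Here \<open>k \<ge> 1\<close> matters: one copy of \<open>w t\<close> is split
    off and the other \<open>l\<close> copies are nonnegative.\<close>
  have "w t + 0 \<le> w t + (\<Sum>i<l. w t)"
    using assms(4) by (intro add_left_mono sum_nonneg) auto
  then have "w t \<le> (\<Sum>i<k. w t)" using l by (simp add: lessThan_Suc)
  then have "w t + w c \<le> (\<Sum>i<k. w t) + (\<Sum>i<k. w x)"
    using c(2) by (simp add: add_right_mono)
  also have "\<dots> = (\<Sum>i<k. w t + w x)" by (simp add: sum.distrib)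
  also have "\<dots> \<le> w c" unfolding c(2)[symmetric] using le by (rule sum_mono)
  finally have "w t + w c + w (inv c) \<le> w c + w (inv c)" by (rule add_right_mono)
  moreover have "w c + w (inv c) = 0" using w_inv[OF c(1)] by (simp add: add.commute)
  ultimately have "w t \<le> 0" by (simp add: add.assoc)
  then show False using assms(4) by simp
qed

text \<open>Elements whose value is bounded below by a positive value from \<open>F\<close> thus
  behave as if they lay in the Jacobson radical of \<open>O_w\<close>.\<close>

lemma prime_not_near_one:
  assumes Q: "primeideal Q (E\<lparr>carrier := O_w\<rparr>)"
    and P: "ideal (Q \<inter> O_F) (E\<lparr>carrier := O_F\<rparr>)"
    and z: "z \<in> carrier E" "t \<in> F" "0 < w t" "w t \<le> w z"
  shows "\<one> \<ominus> z \<notin> Q"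
proof
  define q where "q = \<one> \<ominus> z"
  assume "\<one> \<ominus> z \<in> Q"
  then have q: "q \<in> Q" "q \<in> carrier E" using z by (auto simp: q_def)
  have Qi: "ideal Q (E\<lparr>carrier := O_w\<rparr>)" using Q by (rule primeideal.axioms)
  have "\<one> \<notin> Q"
    using ideal.one_imp_carrier[OF Qi] primeideal.I_notcarr[OF Q] by auto
  let ?J = "value_ideal (Q \<inter> O_F)"
  obtain p where "set p \<subseteq> O_F" "\<one> \<in> set p" "eval p q = \<zero>"
    using ex_primitive_equation[OF q(2)] .
  then obtain b where b: "b \<in> O_w" "b \<notin> ?J" "b \<otimes> q \<in> ?J"
    using ex_zero_divisor_mod[OF Qi P q(1), of p] \<open>\<one> \<notin> Q\<close> ideal_O_wD(2)[OF ideal_value_ideal[OF P]]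
    by auto
  then have bE: "b \<in> carrier E" by (simp add: O_w_iff)
  have "b \<noteq> \<zero>" using b(2) ideal_O_wD(2)[OF ideal_value_ideal[OF P]] by auto
  obtain r where r: "r \<in> Q \<inter> O_F" "w r \<le> w (b \<otimes> q)"
    using b(3) by (auto simp: value_ideal_def)
  have "\<not> w r \<le> w b" using b(1,2) r(1) by (auto simp: value_ideal_def)
  \<comment> \<open>As \<open>q = \<one> \<ominus> z\<close>, the sum is \<open>b\<close>. The
    minimum cannot be attained at \<open>b \<otimes> q\<close>, since then
    \<open>w r \<le> w b\<close> would put \<open>b\<close> into the extended ideal.\<close>
  have "min (w (b \<otimes> q)) (w (z \<otimes> b)) \<le> w (b \<otimes> q \<oplus> z \<otimes> b)"
    using bE q z by (intro qval_add) auto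
  also have "b \<otimes> q \<oplus> z \<otimes> b = b" unfolding q_def using bE z(1) by algebra
  finally have "w (z \<otimes> b) \<le> w b" using r(2) \<open>\<not> w r \<le> w b\<close> by (auto simp: min_def split: if_splits)
  moreover have "w t + w b \<le> w z + w b" using z(4) by (rule add_right_mono)
  moreover have "w z + w b \<le> w (z \<otimes> b)" using bE z(1) by (rule qval_mult[rotated])
  ultimately show False using not_add_le[OF bE \<open>b \<noteq> \<zero>\<close> z(2,3)] by force
qed

section \<open>Going up for the restriction of the quasi-valuation\<close>

text \<open>A prime above \<open>Q0 + value_ideal P1\<close> contains \<open>P1\<close>; if it also
  avoids \<open>O_F - P1\<close>, its contraction is exactly \<open>P1\<close>. The work lies in
  showing that the sum avoids this set.\<close>

lemma going_up: "going_up E O_F O_w"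
  unfolding going_up_def
proof (intro allI impI, elim conjE)
  fix P0 P1 Q0
  assume P0: "primeideal P0 (E\<lparr>carrier := O_F\<rparr>)" and P1: "primeideal P1 (E\<lparr>carrier := O_F\<rparr>)"
    and P01: "P0 \<subseteq> P1" and Q0: "primeideal Q0 (E\<lparr>carrier := O_w\<rparr>)" and Q0P0: "Q0 \<inter> O_F = P0"
  interpret Ow: cring "E\<lparr>carrier := O_w\<rparr>" by (rule cring_O_w)
  note P1i = primeideal.axioms(1)[OF P1] and Q0i = primeideal.axioms(1)[OF Q0]
  have one: "\<one> \<in> O_F" using F_simps(3) w_one by (simp add: O_F_iff)
  define S where "S = O_F - P1"
  let ?I = "Q0 <+>\<^bsub>E\<lparr>carrier := O_w\<rparr>\<^esub> value_ideal P1"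
  have Ii: "ideal ?I (E\<lparr>carrier := O_w\<rparr>)"
    by (rule Ow.add_ideals[OF Q0i ideal_value_ideal[OF P1i]])
  have "s \<notin> S" if sI: "s \<in> ?I" for s
  proof
    assume "s \<in> S"
    then have s: "s \<in> O_F" "s \<notin> P1" by (auto simp: S_def)
    then have sF: "s \<in> F - {\<zero>}" using ideal_O_FD(2)[OF P1i] by (auto simp: O_F_iff)
    obtain q x where q: "q \<in> Q0" and x: "x \<in> value_ideal P1" and sqx: "s = q \<oplus> x"
      using sI unfolding set_add_def' by auto
    have qE: "q \<in> carrier E" using q ideal_O_wD(1)[OF Q0i] by (auto simp: O_w_iff)
    obtain p where p: "p \<in> P1" "w p \<le> w x" and xE: "x \<in> carrier E"
      using x by (auto simp: value_ideal_def O_w_iff)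
    have pF: "p \<in> F" using p ideal_O_FD(1)[OF P1i] by (auto simp: O_F_iff)
    note sinv = F_simps(8)[OF sF] F_simps(9)[OF sF]
    \<comment> \<open>Otherwise \<open>p\<close> would divide \<open>s\<close> in
      \<open>O_F\<close>, which puts \<open>s\<close> into \<open>P1\<close>.\<close>
    have "w s < w p"
    proof (rule ccontr)
      assume "\<not> w s < w p"
      then have le: "w p \<le> w s" by simp
      have "p \<noteq> \<zero>" using le qval_zero eq_zero_if_w_Infty[of s] sF F_carrier by (cases "w s") auto
      then have pF': "p \<in> F - {\<zero>}" using pF by simp
      have "p \<otimes> (inv p \<otimes> s) \<in> P1"
        using inv_mult_O_F[OF _ pF' le] sF p(1) ideal_O_FD(3)[OF P1i] by blast
      also have "p \<otimes> (inv p \<otimes> s) = s"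
        using F_simps(8,9)[OF pF'] F_carrier pF sF by (metis m_assoc l_one DiffD1)
      finally show False using s by simp
    qed
    \<comment> \<open>Dividing \<open>s = q \<oplus> x\<close> by \<open>s\<close> turns
      \<open>q\<close> into \<open>\<one> \<ominus> z\<close>, and \<open>t\<close> is the element
      of \<open>F\<close> of positive value that bounds \<open>w z\<close> from below.\<close>
    define t where "t = inv s \<otimes> p"
    define z where "z = inv s \<otimes> x"
    have zE: "z \<in> carrier E" and tF: "t \<in> F"
      using sinv F_carrier xE F_simps(6) pF by (auto simp: z_def t_def)
    have wt: "w t = w (inv s) + w p" using w_mult sinv pF by (simp add: t_def)
    have "0 < w t"
    proof (rule ccontr)
      assume "\<not> 0 < w t"
      then have "w s + (w (inv s) + w p) \<le> w s + 0" unfolding wt by (intro add_left_mono) simp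
      moreover have "w s + (w (inv s) + w p) = w p"
        using w_inv[OF sF] by (metis add.assoc add.commute add.left_neutral)
      ultimately show False using \<open>w s < w p\<close> by simp
    qed
    have "w t \<le> w (inv s) + w x" unfolding wt using p(2) by (rule add_left_mono)
    also have "\<dots> \<le> w z" unfolding z_def using sinv F_carrier xE by (intro qval_mult) auto
    finally have tz: "w t \<le> w z" .
    have far: "\<one> \<ominus> z \<notin> Q0"
      using prime_not_near_one[OF Q0 _ zE tF \<open>0 < w t\<close> tz] primeideal.axioms(1)[OF P0] Q0P0 by simp
    have "z \<in> O_w" using zE tz \<open>0 < w t\<close> by (simp add: O_w_iff)
    then have zO: "\<one> \<ominus> z \<in> O_w"
      using O_w_add O_w_minus one O_F_subset by (auto simp: a_minus_def)
    \<comment> \<open>Multiplying back by \<open>s\<close> recovers \<open>q\<close>. As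
      \<open>\<one> \<ominus> z\<close> is not in the prime \<open>Q0\<close>, the factor
      \<open>s\<close> must be, and so \<open>s\<close> lies in \<open>P0\<close>, hence in
      \<open>P1\<close>.\<close>
    have "s \<otimes> (\<one> \<ominus> z) = s \<ominus> (s \<otimes> inv s) \<otimes> x"
      unfolding z_def using F_carrier[of s] F_carrier[of "inv s"] sF sinv(1) xE
      by (simp add: a_minus_def r_distr r_minus m_assoc)
    also have "\<dots> = q"
      unfolding sinv(2) unfolding sqx using qE xE by algebra
    finally have "s \<otimes> (\<one> \<ominus> z) \<in> Q0" using q by simp
    then have "s \<in> Q0"
      using primeideal.I_prime[OF Q0, of s "\<one> \<ominus> z"] far zO s(1) O_F_subset by auto
    then show False using s Q0P0 P01 by auto
  qed
  then have disj: "?I \<inter> S = {}" by blast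
  have "\<one> \<notin> P1"
    using ideal.one_imp_carrier[OF P1i] primeideal.I_notcarr[OF P1] by auto
  then have "\<one> \<in> S" using one by (simp add: S_def)
  moreover have "x \<otimes> y \<in> S" if "x \<in> S" "y \<in> S" for x y
    using that primeideal.I_prime[OF P1, of x y] w_mult F_simps(6)
    by (auto simp: S_def O_F_iff)
  ultimately obtain Q1 where Q1: "primeideal Q1 (E\<lparr>carrier := O_w\<rparr>)" "?I \<subseteq> Q1" "Q1 \<inter> S = {}"
    using Ow.ex_primeideal_disjoint[OF Ii _ _ disj] by auto
  note sub = Ow.ideal_subset_set_add[OF Q0i ideal_value_ideal[OF P1i]]
  have "P1 \<subseteq> value_ideal P1"
    using ideal_O_FD(1)[OF P1i] O_F_subset by (auto simp: value_ideal_def)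
  with sub have "Q0 \<subseteq> ?I" "P1 \<subseteq> ?I" by auto
  moreover have "P1 \<subseteq> O_F" by (rule ideal_O_FD(1)[OF P1i])
  ultimately show "\<exists>Q1. primeideal Q1 (E\<lparr>carrier := O_w\<rparr>) \<and> Q0 \<subseteq> Q1 \<and> Q1 \<inter> O_F = P1"
    using Q1 by (intro exI[of _ Q1]) (auto simp: S_def)
qed

end

section \<open>Transfer from the valuation to its copy inside the quasi-valuation\<close>

theorem theorem5p16:
  fixes E :: "('a, 'b) ring_scheme"
    and F :: "'a set"
    and v :: "'a \<Rightarrow> 'g::linordered_ab_group_add with_infinity"
    and w :: "'a \<Rightarrow> 'm::{linorder, ordered_comm_monoid_add} with_infinity"
    and \<iota> :: "'g \<Rightarrow> 'm"
  assumes "field E"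
    and "subfield F E"
    and "ring.finite_dimension E F (carrier E)"
    and "valuation (E\<lparr>carrier := F\<rparr>) v"
    and "quasi_valuation E w"
    and "extends_valuation (E\<lparr>carrier := F\<rparr>) v \<iota> w"
    and "torsion_over E w (\<iota> ` value_group (E\<lparr>carrier := F\<rparr>) v)"
  shows "going_up E (nonneg_ring (E\<lparr>carrier := F\<rparr>) v) (nonneg_ring E w)"
proof -
  interpret field E by fact
  let ?\<Gamma> = "value_group (E\<lparr>carrier := F\<rparr>) v"
  have wv: "w x = map_with_infinity \<iota> (v x)" if "x \<in> F" for x
    using assms(6) that by (simp add: extends_valuation_def)
  have \<iota>: "\<iota> 0 = 0" "\<And>a b. a \<in> ?\<Gamma> \<Longrightarrow> b \<in> ?\<Gamma> \<Longrightarrow> \<iota> (a + b) = \<iota> a + \<iota> b"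
    "\<And>a b. a \<in> ?\<Gamma> \<Longrightarrow> b \<in> ?\<Gamma> \<Longrightarrow> \<iota> a \<le> \<iota> b \<longleftrightarrow> a \<le> b"
    using assms(6) by (auto simp: extends_valuation_def ordered_monoid_embedding_def)
  note F = subringE[OF subfieldE(1)[OF assms(2)]]
  have v_Infty: "v x = Infty \<longleftrightarrow> x = \<zero>\<^bsub>E\<^esub>" if "x \<in> F" for x
    using valuation.val_eq_Infty_iff[OF assms(4)] that by simp
  have v_mult: "v (x \<otimes>\<^bsub>E\<^esub> y) = v x + v y" if "x \<in> F" "y \<in> F" for x y
    using valuation.val_mult[OF assms(4)] that by simp
  have v_Fin: "\<gamma> \<in> ?\<Gamma>" if "x \<in> F" "v x = Fin \<gamma>" for x \<gamma>
    using that v_Infty by (force simp: value_group_def)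
  \<comment> \<open>The value of \<open>\<one>\<close> is finite and idempotent under addition,
    hence 0 in the group.\<close>
  have v_one: "v \<one>\<^bsub>E\<^esub> = 0"
    using v_mult[OF F(3) F(3)] v_Infty[OF F(3)]
    by (cases "v \<one>\<^bsub>E\<^esub>") (auto simp: zero_with_infinity_def)
  then have zero: "0 \<in> ?\<Gamma>"
    using v_Fin[OF F(3)] by (simp add: zero_with_infinity_def)
  have "torsion_quasi_valuation E w F"
  proof (intro torsion_quasi_valuation.intro torsion_quasi_valuation_axioms.intro)
    show "w \<one>\<^bsub>E\<^esub> = 0"
      using wv[OF F(3)] v_one \<iota>(1) by (simp add: zero_with_infinity_def)
    show "w (x \<otimes>\<^bsub>E\<^esub> y) = w x + w y" if "x \<in> F" "y \<in> F" for x y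
      using that F(6) v_mult[OF that] v_Fin \<iota>(2)
      by (cases "v x"; cases "v y") (simp_all add: wv)
    have "\<iota> ` ?\<Gamma> \<subseteq> {m. \<exists>c\<in>F - {\<zero>\<^bsub>E\<^esub>}. w c = Fin m}"
      using wv by (force simp: value_group_def)
    then have "Fin ` \<iota> ` ?\<Gamma> \<subseteq> Fin ` {m. \<exists>c\<in>F - {\<zero>\<^bsub>E\<^esub>}. w c = Fin m}"
      by (rule image_mono)
    then show "torsion_over E w {m. \<exists>c\<in>F - {\<zero>\<^bsub>E\<^esub>}. w c = Fin m}"
      using assms(7) unfolding torsion_over_def by (meson subsetD)
    show "(ring.algebraic E over F) x" if "x \<in> carrier E" for x
      using finite_dimension_imp_algebraic[OF assms(2) carrier_is_subring assms(3) that] .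
  qed fact+
  then have "going_up E (nonneg_ring (E\<lparr>carrier := F\<rparr>) w) (nonneg_ring E w)"
    by (rule torsion_quasi_valuation.going_up)
  \<comment> \<open>Since 0 belongs to the value group, on which \<open>\<iota>\<close> preserves
    and reflects the order, \<open>v\<close> and \<open>w\<close> define the same ring in
    \<open>F\<close>.\<close>
  moreover have "0 \<le> w x \<longleftrightarrow> 0 \<le> v x" if "x \<in> F" for x
    using wv[OF that] v_Fin[OF that] \<iota>(3)[OF zero] \<iota>(1)
    by (cases "v x") (auto simp: zero_with_infinity_def)
  then have "nonneg_ring (E\<lparr>carrier := F\<rparr>) w = nonneg_ring (E\<lparr>carrier := F\<rparr>) v"
    by (auto simp: nonneg_ring_def)
  ultimately show ?thesis by simp
qed

end
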